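(* Let $X\subseteq\mathbb{Z}^2\setminus\{O\}$ be an arbitrary (finite or infinite) step set. Then the following are equivalent: (i) $X$ has the Infinite Paths Property (IPP); (ii) $O\in\operatorname{Conv}(X)$; (iii) the monoid $\mathcal{A}_X$ has non-trivial units (i.e. an invertible element other than $O$); (iv) the digraph $\Gamma_X$ has non-trivial directed cycles.
   Context: Write $O=(0,0)$ and $\mathbb{N}=\{0,1,2,\ldots\}$. A step set is any subset $X$ of $\mathbb{Z}^2\setminus\{O\}$ (finite or infinite, possibly empty). $\mathcal{F}_X$ is the free monoid on $X$: all words $A_1\cdots A_k$ ($k\in\mathbb{N}$, $A_i\in X$), including the empty word. $\mathcal{A}_X$ is the additive submonoid of $\mathbb{Z}^2$ generated by $X$, with identity $O$. The surjective homomorphism $\alpha_X:\mathcal{F}_X\to\mathcal{A}_X$ is $\alpha_X(A_1\cdots A_k)=A_1+\cdots+A_k$. For $A\in\mathbb{Z}^2$, $\pi_X(A)\in\mathbb{N}\cup\{\infty\}$ is the number of words $w\in\mathcal{F}_X$ with $\alpha_X(w)=A$. $X$ has the IPP if $\pi_X(A)=\infty$ for all $A\in\mathcal{A}_X$. $\operatorname{Conv}(X)$ is the convex hull of $X$ in $\mathbb{R}^2$ (the set of all convex combinations of finite collections of points of $X$). $\Gamma_X$ is the digraph with vertex set $\mathcal{A}_X$ and with an edge, labelled $B$, from $A$ to $A+B$ for each $A\in\mathcal{A}_X$ and each $B\in X$. A non-trivial directed cycle is a closed directed path with at least one edge. *)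

theory Defs
  imports
    "HOL-Analysis.Analysis"
    "HOL-Library.Extended_Nat"
    "HOL-Algebra.Group"
    "Graph_Theory.Arc_Walk"
begin

type_synonym point = "int \<times> int"

definition step_set :: "point set \<Rightarrow> bool" where
  "step_set X \<longleftrightarrow> (0, 0) \<notin> X"

text \<open>The words over \<open>X\<close>, i.e. the elements of the free monoid, are the lists in \<^term>\<open>lists X\<close>.\<close>

definition endpoint :: "point list \<Rightarrow> point" where
  "endpoint w = sum_list w"

definition num_words :: "point set \<Rightarrow> point \<Rightarrow> enat" where
  "num_words X A =
    (let W = {w \<in> lists X. endpoint w = A}
     in if finite W then enat (card W) else \<infinity>)"

definition plane_monoid :: "point monoid" where
  "plane_monoid = \<lparr>carrier = UNIV, mult = (+), one = (0, 0)\<rparr>"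

definition step_monoid :: "point set \<Rightarrow> point monoid" where
  "step_monoid X = plane_monoid
    \<lparr>carrier := \<Inter>{H. submonoid H plane_monoid \<and> X \<subseteq> H}\<rparr>"

definition IPP :: "point set \<Rightarrow> bool" where
  "IPP X \<longleftrightarrow> (\<forall>A \<in> carrier (step_monoid X). num_words X A = \<infinity>)"

definition real_point :: "point \<Rightarrow> real \<times> real" where
  "real_point A = (real_of_int (fst A), real_of_int (snd A))"

definition Conv :: "point set \<Rightarrow> (real \<times> real) set" where
  "Conv X = convex hull (real_point ` X)"

text \<open>The arc \<open>(A, B)\<close> is the edge with label \<open>B\<close> from \<open>A\<close> to \<open>A + B\<close>.\<close>

definition step_digraph :: "point set \<Rightarrow> (point, point \<times> point) pre_digraph" where
  "step_digraph X =
    \<lparr>verts = carrier (step_monoid X),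
     arcs = carrier (step_monoid X) \<times> X,
     tail = (\<lambda>(A, B). A),
     head = (\<lambda>(A, B). A + B)\<rparr>"

text \<open>
  A non-trivial directed cycle is a closed walk with at least one arc; unlike
  \<^const>\<open>pre_digraph.cycle\<close>, it may revisit vertices.
\<close>

definition nontrivial_directed_cycle :: "('a, 'b) pre_digraph \<Rightarrow> 'b list \<Rightarrow> bool" where
  "nontrivial_directed_cycle G p \<longleftrightarrow> p \<noteq> [] \<and> (\<exists>u. pre_digraph.awalk G u p u)"

lemma submonoid_plane_iff:
  "submonoid H plane_monoid \<longleftrightarrow> (0, 0) \<in> H \<and> (\<forall>A \<in> H. \<forall>B \<in> H. A + B \<in> H)"
  by (auto simp add: submonoid_def plane_monoid_def Ball_def simp del: split_paired_All)

lemma carrier_step_monoid: "carrier (step_monoid X) = endpoint ` lists X"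
proof
  have "submonoid (endpoint ` lists X) plane_monoid"
    unfolding submonoid_plane_iff
  proof (intro conjI ballI)
    show "(0, 0) \<in> endpoint ` lists X"
      by (rule image_eqI[of _ _ "[]"]) (auto simp: endpoint_def zero_prod_def)
    fix A B assume "A \<in> endpoint ` lists X" "B \<in> endpoint ` lists X"
    then obtain v w where "v \<in> lists X" "w \<in> lists X" "A = endpoint v" "B = endpoint w"
      by blast
    then show "A + B \<in> endpoint ` lists X"
      by (intro image_eqI[of _ _ "v @ w"]) (auto simp: endpoint_def)
  qed
  moreover have "X \<subseteq> endpoint ` lists X"
  proof
    fix A assume "A \<in> X"
    then show "A \<in> endpoint ` lists X"
      by (intro image_eqI[of _ _ "[A]"]) (auto simp: endpoint_def)
  qed
  ultimately show "carrier (step_monoid X) \<subseteq> endpoint ` lists X"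
    by (auto simp: step_monoid_def)
next
  have "endpoint w \<in> H" if "w \<in> lists X" "submonoid H plane_monoid" "X \<subseteq> H" for w H
    using that by (induction w) (auto simp: submonoid_plane_iff endpoint_def zero_prod_def)
  then show "endpoint ` lists X \<subseteq> carrier (step_monoid X)"
    unfolding step_monoid_def by fastforce
qed

lemma monoid_step_monoid: "Group.monoid (step_monoid X)"
  by (rule Group.monoid.intro)
    (auto simp: step_monoid_def plane_monoid_def submonoid_def zero_prod_def[symmetric] add.assoc)

lemma wf_step_digraph: "wf_digraph (step_digraph X)"
proof
  fix e assume "e \<in> arcs (step_digraph X)"
  then show "tail (step_digraph X) e \<in> verts (step_digraph X)"
    and "head (step_digraph X) e \<in> verts (step_digraph X)"
    by (auto simp: step_digraph_def step_monoid_def submonoid_plane_iff)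
qed

end

theory Submission
  imports Defs
begin

text \<open>
  Each of the four conditions amounts to the existence of a non-empty word over \<open>X\<close> with endpoint
  \<open>O\<close>. The only non-formal step is to pass from a real convex combination
  \<open>\<Sum>i. u i * x i = O\<close> to such a word: Dirichlet's simultaneous approximation theorem
  provides a common multiplier \<open>q \<ge> 1\<close> for which the numbers \<open>q * u i\<close> are so close to integers
  \<open>p i\<close> that the lattice point \<open>\<Sum>i. p i * x i\<close> has coordinates of absolute value below 1,
  hence vanishes; the \<open>p i\<close> are non-negative, and not all zero.
\<close>

section \<open>Null words and endpoints\<close>

definition has_null_word :: "point set \<Rightarrow> bool" where
  "has_null_word X \<longleftrightarrow> (\<exists>w \<in> lists X. w \<noteq> [] \<and> endpoint w = 0)"

lemma endpoint_simps [simp]: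
  "endpoint [] = 0"
  "endpoint (A # w) = A + endpoint w"
  "endpoint (v @ w) = endpoint v + endpoint w"
  by (simp_all add: endpoint_def)

lemma endpoint_replicate: "endpoint (replicate n A) = (int n * fst A, int n * snd A)"
  by (induction n) (auto simp: zero_prod_def algebra_simps prod_eq_iff)

lemma endpoint_concat: "endpoint (concat ws) = (\<Sum>w\<leftarrow>ws. endpoint w)"
  by (induction ws) auto

lemma real_point_0: "real_point 0 = 0"
  by (simp add: real_point_def zero_prod_def)

lemma real_point_add: "real_point (A + B) = real_point A + real_point B"
  by (simp add: real_point_def)

lemma real_point_endpoint: "real_point (endpoint w) = (\<Sum>A\<leftarrow>w. real_point A)"
  by (induction w) (simp_all add: real_point_0 real_point_add)

section \<open>Null words and units of the monoid\<close>

lemma has_null_word_iff_Units: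
  assumes "step_set X"
  shows "has_null_word X \<longleftrightarrow> (\<exists>U \<in> Units (step_monoid X). U \<noteq> (0, 0))"
proof
  assume "has_null_word X"
  \<comment> \<open>The first letter \<open>A\<close> of a null word is a unit whose inverse is the
    sum of the remaining letters; \<open>step_set X\<close> ensures that it is not the
    origin.\<close>
  then obtain A w where w: "A \<in> X" "w \<in> lists X" "A + endpoint w = 0"
    unfolding has_null_word_def by (metis endpoint_simps(2) Cons_in_lists_iff neq_Nil_conv)
  have "A = endpoint [A]" "[A] \<in> lists X"
    using w by auto
  then have "A \<in> carrier (step_monoid X)" "endpoint w \<in> carrier (step_monoid X)"
    using w unfolding carrier_step_monoid by blast+
  then have "A \<in> Units (step_monoid X)"
    using w unfolding Units_def
    by (auto simp: step_monoid_def plane_monoid_def zero_prod_def add.commute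
        intro!: bexI[of _ "endpoint w"])
  moreover have "A \<noteq> (0, 0)"
    using assms w by (auto simp: step_set_def)
  ultimately show "\<exists>U \<in> Units (step_monoid X). U \<noteq> (0, 0)"
    by blast
next
  assume "\<exists>U \<in> Units (step_monoid X). U \<noteq> (0, 0)"
  then obtain U V where UV: "U \<in> carrier (step_monoid X)" "V \<in> carrier (step_monoid X)"
      "U + V = 0" "U \<noteq> 0"
    by (auto simp: Units_def step_monoid_def plane_monoid_def zero_prod_def)
  then obtain v w where "v \<in> lists X" "w \<in> lists X" "U = endpoint v" "V = endpoint w"
    unfolding carrier_step_monoid by blast
  \<comment> \<open>The word \<open>v @ w\<close> has endpoint \<open>U + V = 0\<close>, and
    \<open>U \<noteq> 0\<close> rules out that it is empty.\<close>
  with UV show "has_null_word X"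
    unfolding has_null_word_def by (intro bexI[of _ "v @ w"]) auto
qed

section \<open>Null words and directed cycles\<close>

lemma cas_step_digraph:
  assumes "pre_digraph.cas (step_digraph X) u p v"
  shows "v = u + endpoint (map snd p)"
  using assms
proof (induction p arbitrary: u)
  case (Cons e p)
  have "pre_digraph.cas (step_digraph X) (u + snd e) p v"
    using Cons.prems by (cases e) (simp add: pre_digraph.cas.simps step_digraph_def)
  from Cons.IH[OF this] show ?case
    by (simp add: add.assoc)
qed (simp add: pre_digraph.cas.simps)

text \<open>Prefix sums of \<open>w\<close> added to \<open>u\<close> stay in the monoid, so a word
  can be read as a walk letter by letter. For a null word the resulting walk is closed.\<close>

lemma awalk_step_digraph:
  assumes "u \<in> carrier (step_monoid X)" "w \<in> lists X"
  obtains p where "pre_digraph.awalk (step_digraph X) u p (u + endpoint w)" "map snd p = w"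
proof -
  have "\<exists>p. pre_digraph.awalk (step_digraph X) u p (u + endpoint w) \<and> map snd p = w"
    using assms(2,1)
  proof (induction w arbitrary: u)
    case Nil
    then show ?case
      by (intro exI[of _ "[]"])
        (auto simp: pre_digraph.awalk_def pre_digraph.cas.simps step_digraph_def)
  next
    case (Cons A w)
    obtain v where "v \<in> lists X" "u = endpoint v"
      using Cons.prems unfolding carrier_step_monoid by blast
    then have "u + A = endpoint (v @ [A])" "v @ [A] \<in> lists X"
      using Cons.hyps by auto
    then have "u + A \<in> carrier (step_monoid X)"
      unfolding carrier_step_monoid by blast
    from Cons.IH[OF this] obtain p where
      "pre_digraph.awalk (step_digraph X) (u + A) p (u + A + endpoint w)" "map snd p = w"
      by blast
    then show ?case
      using Cons.prems Cons.hyps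
      by (intro exI[of _ "(u, A) # p"])
        (auto simp: pre_digraph.awalk_def pre_digraph.cas.simps step_digraph_def add.assoc)
  qed
  then show thesis
    using that by blast
qed

text \<open>Labels telescope along a walk, so a walk is closed exactly when its label word has
  endpoint zero; the walk and its label word have the same length.\<close>

lemma has_null_word_iff_cycle:
  "has_null_word X \<longleftrightarrow> (\<exists>p. nontrivial_directed_cycle (step_digraph X) p)"
proof
  assume "has_null_word X"
  then obtain w where w: "w \<in> lists X" "w \<noteq> []" "endpoint w = 0"
    unfolding has_null_word_def by blast
  have "endpoint w \<in> carrier (step_monoid X)"
    using w(1) unfolding carrier_step_monoid by blast
  from awalk_step_digraph[OF this w(1)] obtain p where
    "pre_digraph.awalk (step_digraph X) (endpoint w) p (endpoint w + endpoint w)" "map snd p = w" .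
  then have "pre_digraph.awalk (step_digraph X) 0 p 0" "p \<noteq> []"
    using w by auto
  then show "\<exists>p. nontrivial_directed_cycle (step_digraph X) p"
    unfolding nontrivial_directed_cycle_def by blast
next
  assume "\<exists>p. nontrivial_directed_cycle (step_digraph X) p"
  then obtain p u where p: "p \<noteq> []" "set p \<subseteq> carrier (step_monoid X) \<times> X"
      "pre_digraph.cas (step_digraph X) u p u"
    unfolding nontrivial_directed_cycle_def pre_digraph.awalk_def
    by (auto simp: step_digraph_def)
  have "endpoint (map snd p) = 0"
    using cas_step_digraph[OF p(3)] by simp
  moreover have "map snd p \<in> lists X"
    using p(2) by fastforce
  ultimately show "has_null_word X"
    using p(1) unfolding has_null_word_def by blast
qed

section \<open>Null words and infinitely many paths\<close>

lemma has_null_word_iff_IPP: "has_null_word X \<longleftrightarrow> IPP X"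
proof
  assume "has_null_word X"
  then obtain w where w: "w \<in> lists X" "w \<noteq> []" "endpoint w = 0"
    unfolding has_null_word_def by blast
  have "num_words X (endpoint v) = \<infinity>" if "v \<in> lists X" for v
  proof -
    \<comment> \<open>Prefixing copies of the null word \<open>w\<close> preserves the endpoint of
      \<open>v\<close>, and the lengths \<open>n * length w + length v\<close> tell the resulting
      words apart.\<close>
    let ?f = "\<lambda>n. concat (replicate n w) @ v"
    have "inj ?f"
    proof (rule injI)
      fix m n assume "?f m = ?f n"
      then have "length (?f m) = length (?f n)"
        by (rule arg_cong)
      then show "m = n"
        using w(2) by (auto simp: length_concat sum_list_replicate)
    qed
    moreover have "endpoint (concat (replicate n w)) = 0" for n
      using w(3) by (induction n) auto
    then have "range ?f \<subseteq> {x \<in> lists X. endpoint x = endpoint v}"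
      using w(1) that by (intro image_subsetI CollectI conjI) auto
    ultimately have "infinite {x \<in> lists X. endpoint x = endpoint v}"
      using finite_subset range_inj_infinite by blast
    then show ?thesis
      by (simp add: num_words_def)
  qed
  then show "IPP X"
    unfolding IPP_def carrier_step_monoid by (auto simp del: split_paired_All)
next
  assume "IPP X"
  moreover have "endpoint [] \<in> carrier (step_monoid X)"
    unfolding carrier_step_monoid by (rule imageI) simp
  ultimately have "num_words X (endpoint []) = \<infinity>"
    unfolding IPP_def by (rule bspec)
  then have "infinite {w \<in> lists X. endpoint w = 0}"
    unfolding num_words_def Let_def endpoint_simps(1) by (metis enat.distinct(1))
  \<comment> \<open>The empty word accounts for only one of the infinitely many words ending at the
    origin.\<close>
  then have "\<not> {w \<in> lists X. endpoint w = 0} \<subseteq> {[]}"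
    using finite_subset by blast
  then show "has_null_word X"
    unfolding has_null_word_def by blast
qed

section \<open>Null words and convex combinations\<close>

lemma zero_in_Conv_if_has_null_word:
  assumes "has_null_word X"
  shows "0 \<in> Conv X"
proof -
  obtain w where w: "w \<in> lists X" "w \<noteq> []" "endpoint w = 0"
    using assms unfolding has_null_word_def by blast
  \<comment> \<open>Equal weights on the letters, counted with multiplicity, turn the vanishing sum
    into a convex combination.\<close>
  have "(\<Sum>i<length w. (1 / length w) *\<^sub>R real_point (w ! i)) \<in> Conv X"
    unfolding Conv_def
  proof (rule convex_sum)
    show "real_point (w ! i) \<in> convex hull (real_point ` X)" if "i \<in> {..<length w}" for i
      using that w(1) by (intro hull_inc) (auto simp: in_lists_conv_set)
  qed (use w(2) in auto)
  also have "(\<Sum>i<length w. (1 / length w) *\<^sub>R real_point (w ! i))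
      = (1 / length w) *\<^sub>R (\<Sum>A\<leftarrow>w. real_point A)"
    by (simp add: sum_list_sum_nth scaleR_right.sum atLeast0LessThan scaleR_sum_right)
  also have "\<dots> = 0"
    unfolding real_point_endpoint[symmetric] w(3) real_point_0 by simp
  finally show ?thesis .
qed

text \<open>Repeating each \<open>x i\<close> exactly \<open>n i\<close> times spells the word;
  \<open>n j > 0\<close> makes it non-empty. Indexing by \<open>I\<close> rather than by steps
  allows for the repeated points that \<open>convex_hull_indexed\<close> may supply.\<close>

lemma has_null_word_if_nat_combination:
  assumes "finite I" "\<And>i. i \<in> I \<Longrightarrow> x i \<in> X"
    and "(\<Sum>i\<in>I. int (n i) * fst (x i)) = 0" "(\<Sum>i\<in>I. int (n i) * snd (x i)) = 0"
    and "j \<in> I" "n j > 0"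
  shows "has_null_word X"
proof -
  obtain js where js: "set js = I" "distinct js"
    using finite_distinct_list[OF assms(1)] by blast
  define w where "w = concat (map (\<lambda>i. replicate (n i) (x i)) js)"
  have "endpoint w = (\<Sum>i\<in>I. endpoint (replicate (n i) (x i)))"
    using js by (simp add: w_def endpoint_concat o_def sum_list_distinct_conv_sum_set)
  also have "\<dots> = 0"
    using assms(3,4) by (simp add: endpoint_replicate prod_eq_iff fst_sum snd_sum)
  finally have "endpoint w = 0" .
  moreover have "w \<in> lists X"
    using js assms(2) by (auto simp: w_def)
  moreover have "w \<noteq> []"
    using js assms(5,6) by (auto simp: w_def)
  ultimately show ?thesis
    unfolding has_null_word_def by blast
qed

text \<open>An integer of absolute value below 1 is zero. Here \<open>a\<close> is one coordinate of
  the points and \<open>p i\<close> approximates \<open>q * u i\<close>; since \<open>N\<close>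
  exceeds the total size of the \<open>a i\<close>, errors of at most \<open>1 / N\<close>
  contribute less than 1.\<close>

lemma int_combination_eq_0:
  fixes a :: "'i \<Rightarrow> int" and p :: "'i \<Rightarrow> int" and u :: "'i \<Rightarrow> real"
  assumes "finite I" "N > 0" "(\<Sum>i\<in>I. \<bar>real_of_int (a i)\<bar>) < N"
    and "(\<Sum>i\<in>I. u i * a i) = 0"
    and "\<And>i. i \<in> I \<Longrightarrow> \<bar>q * u i - p i\<bar> \<le> 1 / N"
  shows "(\<Sum>i\<in>I. p i * a i) = 0"
proof -
  \<comment> \<open>Subtracting \<open>q\<close> times the vanishing real combination leaves only
    the approximation errors.\<close>
  have "real_of_int (\<Sum>i\<in>I. p i * a i) = - (\<Sum>i\<in>I. (q * u i - p i) * a i)"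
    using assms(4) by (simp add: left_diff_distrib sum_subtractf mult.assoc flip: sum_distrib_left)
  then have "\<bar>real_of_int (\<Sum>i\<in>I. p i * a i)\<bar> \<le> (\<Sum>i\<in>I. \<bar>(q * u i - p i) * a i\<bar>)"
    by (simp only: abs_minus_cancel sum_abs)
  also have "\<dots> \<le> (\<Sum>i\<in>I. 1 / N * \<bar>real_of_int (a i)\<bar>)"
    unfolding abs_mult by (intro sum_mono mult_right_mono assms(5)) simp_all
  also have "\<dots> = (\<Sum>i\<in>I. \<bar>real_of_int (a i)\<bar>) / N"
    by (simp add: sum_divide_distrib)
  also have "\<dots> < 1"
    using assms(2,3) by simp
  finally show ?thesis
    by linarith
qed

lemma has_null_word_if_zero_in_Conv:
  assumes "0 \<in> Conv X"
  shows "has_null_word X"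
proof -
  obtain k u y where u: "\<forall>i\<in>{1..k::nat}. 0 \<le> u i \<and> y i \<in> real_point ` X"
      "sum u {1..k} = 1" "(\<Sum>i=1..k. u i *\<^sub>R y i) = 0"
    using assms unfolding Conv_def convex_hull_indexed by blast
  define x where "x i = (SOME A. A \<in> X \<and> y i = real_point A)" for i
  have x: "x i \<in> X" "y i = real_point (x i)" if "i \<in> {1..k}" for i
    using someI_ex[of "\<lambda>A. A \<in> X \<and> y i = real_point A"] bspec[OF u(1) that]
    by (auto simp: x_def)
  have eq: "(\<Sum>i=1..k. u i *\<^sub>R real_point (x i)) = 0"
    using u(3) x(2) by simp
  have u1: "(\<Sum>i=1..k. u i * fst (x i)) = 0" and u2: "(\<Sum>i=1..k. u i * snd (x i)) = 0"
    using arg_cong[OF eq, of fst] arg_cong[OF eq, of snd]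
    by (simp_all add: fst_sum snd_sum real_point_def)
  \<comment> \<open>One bound serves three purposes: it dominates the absolute sums of both
    coordinates and, through the summands 1, the number \<open>k\<close> of points.\<close>
  define B where
    "B = (\<Sum>i=1..k. 1 + \<bar>real_of_int (fst (x i))\<bar> + \<bar>real_of_int (snd (x i))\<bar>)"
  obtain N :: nat where N: "B < N"
    using reals_Archimedean2 by blast
  have "0 \<le> B"
    unfolding B_def by (intro sum_nonneg) auto
  with N have "N > 0"
    by simp
  have "real k \<le> B"
    unfolding B_def by (simp add: sum.distrib sum_nonneg)
  have B1: "(\<Sum>i=1..k. \<bar>real_of_int (fst (x i))\<bar>) < N"
    by (rule le_less_trans[OF _ N]) (unfold B_def, intro sum_mono, simp)
  have B2: "(\<Sum>i=1..k. \<bar>real_of_int (snd (x i))\<bar>) < N"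
    by (rule le_less_trans[OF _ N]) (unfold B_def, intro sum_mono, simp)
  \<comment> \<open>The approximation theorem indexes from 0 and the convex combination from 1, so
    \<open>Suc k\<close> numbers are approximated to cover \<open>{1..k}\<close>.\<close>
  obtain q p where "0 < q" and p: "\<And>i. i < Suc k \<Longrightarrow> \<bar>of_int q * u i - of_int (p i)\<bar> < 1 / N"
    using Dirichlet_approx_simult[OF \<open>N > 0\<close>, of "Suc k" u] by metis
  have p_le: "\<bar>of_int q * u i - of_int (p i)\<bar> \<le> 1 / N" if "i \<in> {1..k}" for i
    using p[of i] that by simp
  have "1 / N \<le> (1::real)"
    using \<open>N > 0\<close> by simp
  have p_nonneg: "0 \<le> p i" if "i \<in> {1..k}" for i
  proof -
    have "0 \<le> of_int q * u i"
      using \<open>0 < q\<close> bspec[OF u(1) that] by simp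
    \<comment> \<open>The integer \<open>p i\<close> differs from a non-negative real by less than
      \<open>1 / N\<close>, hence by less than 1.\<close>
    then have "- 1 < real_of_int (p i)"
      using p[of i] that \<open>1 / N \<le> 1\<close> by auto
    then show ?thesis
      by simp
  qed
  have "\<exists>j\<in>{1..k}. p j \<noteq> 0"
  proof (rule ccontr)
    assume "\<not> (\<exists>j\<in>{1..k}. p j \<noteq> 0)"
    \<comment> \<open>If all \<open>p i\<close> were zero, each \<open>q * u i\<close> would be at
      most \<open>1 / N\<close>. As the weights sum to 1, this gives
      \<open>q \<le> k / N < 1\<close>, contradicting \<open>0 < q\<close>.\<close>
    then have "(\<Sum>i=1..k. of_int q * u i) \<le> (\<Sum>i=1..k. 1 / real N)"
      using p_le by (intro sum_mono) fastforce
    then have "of_int q \<le> real k / N"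
      using u(2) by (simp flip: sum_distrib_left)
    also have "\<dots> < 1"
      using \<open>real k \<le> B\<close> N \<open>N > 0\<close> by simp
    finally show False
      using \<open>0 < q\<close> by simp
  qed
  then obtain j where j: "j \<in> {1..k}" "p j \<noteq> 0"
    by blast
  have "(\<Sum>i=1..k. p i * fst (x i)) = 0" "(\<Sum>i=1..k. p i * snd (x i)) = 0"
    using \<open>N > 0\<close> B1 B2 u1 u2 p_le
    by (auto intro!: int_combination_eq_0[where N = "real N" and q = "of_int q" and u = u])
  then have "(\<Sum>i=1..k. int (nat (p i)) * fst (x i)) = 0"
      "(\<Sum>i=1..k. int (nat (p i)) * snd (x i)) = 0"
    using p_nonneg by simp_all
  then show ?thesis
    using x(1) j p_nonneg[OF j(1)]
    by (intro has_null_word_if_nat_combination[of "{1..k}" x X "\<lambda>i. nat (p i)" j]) auto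
qed

theorem theorem2p19:
  fixes X :: "(int \<times> int) set"
  assumes "step_set X"
  shows "(IPP X \<longleftrightarrow> (0, 0) \<in> Conv X)
    \<and> ((0, 0) \<in> Conv X \<longleftrightarrow> (\<exists>U \<in> Units (step_monoid X). U \<noteq> (0, 0)))
    \<and> ((\<exists>U \<in> Units (step_monoid X). U \<noteq> (0, 0)) \<longleftrightarrow>
        (\<exists>p. nontrivial_directed_cycle (step_digraph X) p))"
proof -
  have "has_null_word X \<longleftrightarrow> (0, 0) \<in> Conv X"
    using zero_in_Conv_if_has_null_word has_null_word_if_zero_in_Conv
    unfolding zero_prod_def by blast
  then show ?thesis
    using has_null_word_iff_IPP[of X] has_null_word_iff_Units[OF assms]
      has_null_word_iff_cycle[of X]
    by blast
qed

end
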